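(* Let $m\ge 1$, let $\mathbf N=(N_1,\dots,N_m)$ with every $N_\nu\ge 3$, and let $\mathbb T_{\mathbf N}=\prod_{\nu=1}^m\mathbb Z/N_\nu\mathbb Z$. Let $q:\mathbb T_{\mathbf N}\to\mathbb R$ and $r_\nu^{\pm}:\mathbb T_{\mathbf N}\to(0,\infty)$ ($1\le\nu\le m$), and let $\mathcal M$ be the operator on $\mathbb R^{\mathbb T_{\mathbf N}}$ $$(\mathcal M u)(x)=q_xu(x)+\sum_{\nu=1}^m\left[r_\nu^+(x)u(x+e_\nu)+r_\nu^-(x)u(x-e_\nu)\right],$$ with principal eigenvalue $\Lambda(\mathcal M)$. With $\mathcal P_{\mathbf N}$, $\mathcal Z_{\mathbf N}$, $\mathcal F_{\mathcal M}$ and $H_\beta$ as defined in the context, $$\Lambda(\mathcal M)=\min_{\beta\in\mathcal Z_{\mathbf N}}\lambda_{\max}(H_\beta)=\min_{\beta\in\mathcal Z_{\mathbf N}}\ \max_{a\in\mathcal P_{\mathbf N}}\mathcal F_{\mathcal M}(a,\beta)=\max_{a\in\mathcal P_{\mathbf N}}\ \min_{\beta\in\mathcal Z_{\mathbf N}}\mathcal F_{\mathcal M}(a,\beta).$$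
   Context: Here $e_\nu$ is the $\nu$-th standard unit vector and site arithmetic is periodic (modulo $N_\nu$ in coordinate $\nu$). The matrix of $\mathcal M$ is irreducible and Metzler (nonnegative off-diagonal entries); its principal eigenvalue $\Lambda(\mathcal M)$ is its spectral bound (largest real part of an eigenvalue), which is a real, algebraically simple eigenvalue with positive right and left eigenvectors. For each $x\in\mathbb T_{\mathbf N}$ and $1\le\nu\le m$, $$\kappa_{x,\nu}:=\sqrt{r_\nu^+(x)\,r_\nu^-(x+e_\nu)},\qquad \gamma_{x,\nu}:=\frac12\log\frac{r_\nu^+(x)}{r_\nu^-(x+e_\nu)}.$$ $\mathcal P_{\mathbf N}:=\{a:\mathbb T_{\mathbf N}\to(0,\infty):\sum_xa_x^2=1\}$ and $\mathcal Z_{\mathbf N}:=\{\beta:\mathbb T_{\mathbf N}\to\mathbb R:\sum_x\beta_x=0\}$. For $a\in\mathcal P_{\mathbf N}$, $\beta\in\mathcal Z_{\mathbf N}$, $$\mathcal F_{\mathcal M}(a,\beta):=\sum_xq_xa_x^2+2\sum_{x,\nu}\kappa_{x,\nu}a_xa_{x+e_\nu}\cosh\bigl(\beta_{x+e_\nu}-\beta_x+\gamma_{x,\nu}\bigr),$$ where $\sum_{x,\nu}$ runs over $x\in\mathbb T_{\mathbf N}$, $1\le\nu\le m$. With $D_\beta:=\operatorname{diag}(e^{\beta_x})$, $$H_\beta:=\tfrac12\left(D_\beta^{-1}\mathcal M D_\beta+D_\beta\mathcal M^{\mathsf T}D_\beta^{-1}\right),$$ a symmetric matrix, and $\lambda_{\max}(H_\beta)$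 is its largest eigenvalue. *)

theory Defs
  imports Complex_Main "HOL-Library.FuncSet" "Jordan_Normal_Form.Spectral_Radius"
begin

text \<open>
  The side lengths form a list \<open>N\<close> of length \<open>m\<close>, with coordinates numbered from \<open>0\<close>. A site of the
  torus is the list of its canonical residues \<open>x ! \<nu> < N ! \<nu>\<close>. The sites are listed without
  repetition by \<^const>\<open>product_lists\<close>; this enumeration indexes the rows and columns of matrices.
\<close>

definition site_list :: "nat list \<Rightarrow> nat list list" where
  "site_list N = product_lists (map (\<lambda>n. [0..<n]) N)"

definition torus :: "nat list \<Rightarrow> nat list set" where
  "torus N = {x. length x = length N \<and> (\<forall>\<nu><length N. x ! \<nu> < N ! \<nu>)}"

lemma set_site_list: "set (site_list N) = torus N"
  by (auto simp: site_list_def torus_def product_lists_set list_all2_conv_all_nth)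

lemma distinct_site_list: "distinct (site_list N)"
  unfolding site_list_def by (rule distinct_product_lists) auto

definition site_succ :: "nat list \<Rightarrow> nat \<Rightarrow> nat list \<Rightarrow> nat list" where
  "site_succ N \<nu> x = x[\<nu> := (x ! \<nu> + 1) mod (N ! \<nu>)]"

text \<open>Adding \<open>N ! \<nu>\<close> first avoids truncated subtraction at the residue \<open>0\<close>.\<close>

definition site_pred :: "nat list \<Rightarrow> nat \<Rightarrow> nat list \<Rightarrow> nat list" where
  "site_pred N \<nu> x = x[\<nu> := (x ! \<nu> + N ! \<nu> - 1) mod (N ! \<nu>)]"

definition torus_op ::
  "nat list \<Rightarrow> (nat list \<Rightarrow> real) \<Rightarrow> (nat \<Rightarrow> nat list \<Rightarrow> real) \<Rightarrow> (nat \<Rightarrow> nat list \<Rightarrow> real)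
    \<Rightarrow> (nat list \<Rightarrow> real) \<Rightarrow> nat list \<Rightarrow> real" where
  "torus_op N q rp rm u x =
     q x * u x + (\<Sum>\<nu><length N. rp \<nu> x * u (site_succ N \<nu> x) + rm \<nu> x * u (site_pred N \<nu> x))"

text \<open>Column \<open>j\<close> is the image of the indicator function of the \<open>j\<close>-th site.\<close>

definition torus_mat ::
  "nat list \<Rightarrow> (nat list \<Rightarrow> real) \<Rightarrow> (nat \<Rightarrow> nat list \<Rightarrow> real) \<Rightarrow> (nat \<Rightarrow> nat list \<Rightarrow> real) \<Rightarrow> real mat"
  where
  "torus_mat N q rp rm =
     mat (length (site_list N)) (length (site_list N))
       (\<lambda>(i, j). torus_op N q rp rm (\<lambda>x. if x = site_list N ! j then 1 else 0) (site_list N ! i))"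

text \<open>Eigenvalues of the real matrix are taken over the complex numbers.\<close>

definition spectral_bound :: "real mat \<Rightarrow> real" where
  "spectral_bound A = Max (Re ` spectrum (map_mat complex_of_real A))"

definition max_eigenvalue :: "real mat \<Rightarrow> real" where
  "max_eigenvalue A = Max (spectrum A)"

definition principal_eigenvalue ::
  "nat list \<Rightarrow> (nat list \<Rightarrow> real) \<Rightarrow> (nat \<Rightarrow> nat list \<Rightarrow> real) \<Rightarrow> (nat \<Rightarrow> nat list \<Rightarrow> real) \<Rightarrow> real"
  where
  "principal_eigenvalue N q rp rm = spectral_bound (torus_mat N q rp rm)"

definition kappa ::
  "nat list \<Rightarrow> (nat \<Rightarrow> nat list \<Rightarrow> real) \<Rightarrow> (nat \<Rightarrow> nat list \<Rightarrow> real) \<Rightarrow> nat list \<Rightarrow> nat \<Rightarrow> real" where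
  "kappa N rp rm x \<nu> = sqrt (rp \<nu> x * rm \<nu> (site_succ N \<nu> x))"

definition gam ::
  "nat list \<Rightarrow> (nat \<Rightarrow> nat list \<Rightarrow> real) \<Rightarrow> (nat \<Rightarrow> nat list \<Rightarrow> real) \<Rightarrow> nat list \<Rightarrow> nat \<Rightarrow> real" where
  "gam N rp rm x \<nu> = 1 / 2 * ln (rp \<nu> x / rm \<nu> (site_succ N \<nu> x))"

text \<open>Functions on the torus are functions on lists that are \<^const>\<open>undefined\<close> off the torus.\<close>

definition amplitudes :: "nat list \<Rightarrow> (nat list \<Rightarrow> real) set" where
  "amplitudes N = {a \<in> torus N \<rightarrow>\<^sub>E {0<..}. (\<Sum>x\<in>torus N. (a x)\<^sup>2) = 1}"

definition potentials :: "nat list \<Rightarrow> (nat list \<Rightarrow> real) set" where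
  "potentials N = {\<beta> \<in> torus N \<rightarrow>\<^sub>E UNIV. (\<Sum>x\<in>torus N. \<beta> x) = 0}"

definition free_energy ::
  "nat list \<Rightarrow> (nat list \<Rightarrow> real) \<Rightarrow> (nat \<Rightarrow> nat list \<Rightarrow> real) \<Rightarrow> (nat \<Rightarrow> nat list \<Rightarrow> real)
    \<Rightarrow> (nat list \<Rightarrow> real) \<Rightarrow> (nat list \<Rightarrow> real) \<Rightarrow> real" where
  "free_energy N q rp rm a \<beta> =
     (\<Sum>x\<in>torus N. q x * (a x)\<^sup>2)
     + 2 * (\<Sum>x\<in>torus N. \<Sum>\<nu><length N.
              kappa N rp rm x \<nu> * a x * a (site_succ N \<nu> x)
                * cosh (\<beta> (site_succ N \<nu> x) - \<beta> x + gam N rp rm x \<nu>))"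

text \<open>The inverse of \<open>exp_diag N \<beta>\<close> is \<open>exp_diag N (- \<beta>)\<close>.\<close>

definition exp_diag :: "nat list \<Rightarrow> (nat list \<Rightarrow> real) \<Rightarrow> real mat" where
  "exp_diag N \<beta> = mat_diag (length (site_list N)) (\<lambda>i. exp (\<beta> (site_list N ! i)))"

lemma exp_diag_inverse:
  "inverts_mat (exp_diag N \<beta>) (exp_diag N (\<lambda>x. - \<beta> x))"
  "inverts_mat (exp_diag N (\<lambda>x. - \<beta> x)) (exp_diag N \<beta>)"
  by (auto simp: inverts_mat_def exp_diag_def mat_diag_def exp_minus carrier_matI
      mat_diag_diag[unfolded mat_diag_def] simp flip: mat_diag_one)

definition sym_conj ::
  "nat list \<Rightarrow> (nat list \<Rightarrow> real) \<Rightarrow> (nat \<Rightarrow> nat list \<Rightarrow> real) \<Rightarrow> (nat \<Rightarrow> nat list \<Rightarrow> real)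
    \<Rightarrow> (nat list \<Rightarrow> real) \<Rightarrow> real mat" where
  "sym_conj N q rp rm \<beta> =
     (let M = torus_mat N q rp rm; D = exp_diag N \<beta>; D' = exp_diag N (\<lambda>x. - \<beta> x)
      in (1 / 2) \<cdot>\<^sub>m (D' * M * D + D * transpose_mat M * D'))"

text \<open>A minimum or maximum, as opposed to an infimum or supremum: the value is attained on \<open>S\<close>.\<close>

definition has_min :: "'a set \<Rightarrow> ('a \<Rightarrow> real) \<Rightarrow> real \<Rightarrow> bool" where
  "has_min S f v \<longleftrightarrow> (\<exists>x\<in>S. f x = v) \<and> (\<forall>x\<in>S. v \<le> f x)"

definition has_max :: "'a set \<Rightarrow> ('a \<Rightarrow> real) \<Rightarrow> real \<Rightarrow> bool" where
  "has_max S f v \<longleftrightarrow> (\<exists>x\<in>S. f x = v) \<and> (\<forall>x\<in>S. f x \<le> v)"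

end

theory Submission
  imports Defs "HOL-Analysis.Function_Topology"
begin

text \<open>
  Let \<open>u\<close> and \<open>v\<close> be the right and left Perron vectors. Conjugating by \<open>\<beta> = ln (u / v) / 2\<close> makes
  \<open>a = sqrt (u v)\<close> a common eigenvector of the conjugated operator and of its transpose, for the
  principal eigenvalue. So the matrix \<open>W x y = v x * A x y * u y\<close> of the summands of the energy at
  \<open>(a, \<beta>)\<close> has equal row and column sums. By \<open>exp t \<ge> 1 + t\<close> this makes \<open>\<beta>\<close> a minimiser for the
  fixed \<open>a\<close>, and by \<open>2 s t \<le> s\<^sup>2 + t\<^sup>2\<close> it makes \<open>a\<close> a maximiser for the fixed \<open>\<beta>\<close>: a saddle point,
  hence both minimax identities. The remaining extrema are attained because irreducibility makes the
  exponential sums coercive in \<open>\<beta>\<close>, and because each symmetrised matrix has a Perron vector itself.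
\<close>

section \<open>Compactness of bounded sets of centred potentials\<close>

lemma continuous_on_Max_image:
  fixes g :: "'i \<Rightarrow> 'a::topological_space \<Rightarrow> 'b::linorder_topology"
  assumes "finite I" "I \<noteq> {}" "\<And>i. i \<in> I \<Longrightarrow> continuous_on X (g i)"
  shows "continuous_on X (\<lambda>t. Max ((\<lambda>i. g i t) ` I))"
  using assms
proof (induction I rule: finite_ne_induct)
  case (insert i I)
  then have "(\<lambda>t. Max ((\<lambda>i. g i t) ` insert i I)) = (\<lambda>t. max (g i t) (Max ((\<lambda>i. g i t) ` I)))"
    by auto
  with insert show ?case by (auto intro!: continuous_on_max)
qed simp

text \<open>Abstract counterpart of \<open>potentials\<close>. Fixing the value
  \<open>undefined\<close> off \<open>S\<close> makes the part bounded by a given \<open>R\<close>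
  on \<open>S\<close> compact in the product topology on all functions.\<close>

definition zero_sum :: "'a set \<Rightarrow> ('a \<Rightarrow> real) set" where
  "zero_sum S = {\<beta> \<in> S \<rightarrow>\<^sub>E UNIV. (\<Sum>x\<in>S. \<beta> x) = 0}"

text \<open>Tychonoff: intervals on \<open>S\<close> and the singleton of \<open>undefined\<close>
  elsewhere form a compact box, from which the sum condition cuts out a closed part.\<close>

lemma compact_zero_sum_bounded:
  fixes R :: real
  shows "compact {\<beta> \<in> zero_sum S. \<forall>x\<in>S. \<bar>\<beta> x\<bar> \<le> R}"
proof -
  define C where "C = (\<lambda>x. if x \<in> S then {-R..R} else {undefined})"
  have "compactin (product_topology (\<lambda>_. euclidean) UNIV) (PiE UNIV C)"
    unfolding compactin_PiE by (auto simp: C_def)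
  then have "compact (PiE UNIV C)"
    by (simp add: euclidean_product_topology)
  moreover have "closed {\<beta>::'a \<Rightarrow> real. (\<Sum>x\<in>S. \<beta> x) = 0}"
    by (intro closed_Collect_eq continuous_on_sum continuous_on_product_coordinates continuous_on_const)
  ultimately have "compact (PiE UNIV C \<inter> {\<beta>. (\<Sum>x\<in>S. \<beta> x) = 0})"
    by (rule compact_Int_closed)
  moreover have "PiE UNIV C \<inter> {\<beta>. (\<Sum>x\<in>S. \<beta> x) = 0} = {\<beta> \<in> zero_sum S. \<forall>x\<in>S. \<bar>\<beta> x\<bar> \<le> R}"
    by (force simp: PiE_iff C_def zero_sum_def extensional_def abs_le_iff split: if_splits)
  ultimately show ?thesis by simp
qed

text \<open>Normalises a potential modulo constants; energies and Collatz-Wielandt quotients see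
  only differences of its values.\<close>

definition centre :: "'a set \<Rightarrow> ('a \<Rightarrow> real) \<Rightarrow> 'a \<Rightarrow> real" where
  "centre S \<beta> = (\<lambda>x\<in>S. \<beta> x - (\<Sum>y\<in>S. \<beta> y) / card S)"

lemma centre_zero_sum: "finite S \<Longrightarrow> S \<noteq> {} \<Longrightarrow> centre S \<beta> \<in> zero_sum S"
  by (simp add: centre_def zero_sum_def sum_subtractf)

lemma centre_diff: "x \<in> S \<Longrightarrow> y \<in> S \<Longrightarrow> centre S \<beta> y - centre S \<beta> x = \<beta> y - \<beta> x"
  by (simp add: centre_def)

section \<open>Irreducible Metzler kernels and their Perron eigenvectors\<close>

text \<open>Irreducibility is stated by closed sets rather than by paths or powers, so that it
  serves directly as an induction principle along positive entries.\<close>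

locale irreducible_metzler =
  fixes S :: "'a set" and A :: "'a \<Rightarrow> 'a \<Rightarrow> real"
  assumes fin: "finite S" and nonempty: "S \<noteq> {}"
    and offdiag: "\<And>x y. x \<in> S \<Longrightarrow> y \<in> S \<Longrightarrow> x \<noteq> y \<Longrightarrow> A x y \<ge> 0"
    and irreducible: "\<And>C. C \<subseteq> S \<Longrightarrow> C \<noteq> {} \<Longrightarrow>
      (\<And>x y. x \<in> C \<Longrightarrow> y \<in> S \<Longrightarrow> x \<noteq> y \<Longrightarrow> A x y > 0 \<Longrightarrow> y \<in> C) \<Longrightarrow> C = S"
begin

text \<open>The complement of a set closed under reversed arrows is closed under the original ones,
  so it cannot be nonempty and proper.\<close>

lemma irreducible_metzler_transpose: "irreducible_metzler S (\<lambda>x y. A y x)"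
proof
  fix C assume C: "C \<subseteq> S" "C \<noteq> {}"
    "\<And>x y. x \<in> C \<Longrightarrow> y \<in> S \<Longrightarrow> x \<noteq> y \<Longrightarrow> A y x > 0 \<Longrightarrow> y \<in> C"
  show "C = S"
  proof (rule ccontr)
    assume "C \<noteq> S"
    with C have "S - C = S" by (intro irreducible) blast+
    with C show False by auto
  qed
qed (use fin nonempty offdiag in auto)

lemma irreducible_metzler_mono:
  assumes "\<And>x y. x \<in> S \<Longrightarrow> y \<in> S \<Longrightarrow> x \<noteq> y \<Longrightarrow> B x y \<ge> 0"
    and "\<And>x y. x \<in> S \<Longrightarrow> y \<in> S \<Longrightarrow> x \<noteq> y \<Longrightarrow> A x y > 0 \<Longrightarrow> B x y > 0"
  shows "irreducible_metzler S B"
proof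
  fix C assume C: "C \<subseteq> S" "C \<noteq> {}"
    "\<And>x y. x \<in> C \<Longrightarrow> y \<in> S \<Longrightarrow> x \<noteq> y \<Longrightarrow> B x y > 0 \<Longrightarrow> y \<in> C"
  then show "C = S" using assms(2) by (intro irreducible) blast+
qed (use fin nonempty assms in auto)

text \<open>Along an arrow \<open>A x y > 0\<close> the bound \<open>c\<close> caps
  \<open>\<beta> y - \<beta> x\<close> from above. Irreducibility carries such a cap to all ordered
  pairs, hence to absolute differences, and the zero sum turns these into a bound on
  \<open>\<beta>\<close> itself.\<close>

lemma sublevel_bounded:
  "\<exists>R. \<forall>\<beta>\<in>zero_sum S. (\<forall>x\<in>S. \<forall>y\<in>S. x \<noteq> y \<longrightarrow> A x y * exp (\<beta> y - \<beta> x) \<le> c)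
        \<longrightarrow> (\<forall>x\<in>S. \<bar>\<beta> x\<bar> \<le> R)"
proof -
  define L where "L = {\<beta> \<in> zero_sum S. \<forall>x\<in>S. \<forall>y\<in>S. x \<noteq> y \<longrightarrow> A x y * exp (\<beta> y - \<beta> x) \<le> c}"
  \<comment> \<open>The sites whose potential relative to \<open>x\<close> is bounded above
    uniformly on \<open>L\<close> contain \<open>x\<close> and are closed under arrows.\<close>
  have "{y\<in>S. \<exists>R. \<forall>\<beta>\<in>L. \<beta> y - \<beta> x \<le> R} = S" if x: "x \<in> S" for x
  proof (rule irreducible)
    have "\<exists>R. \<forall>\<beta>\<in>L. \<beta> x - \<beta> x \<le> R" by (rule exI[of _ 0]) simp
    then show "{y\<in>S. \<exists>R. \<forall>\<beta>\<in>L. \<beta> y - \<beta> x \<le> R} \<noteq> {}" using x by blast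
  next
    fix y z assume y: "y \<in> {y\<in>S. \<exists>R. \<forall>\<beta>\<in>L. \<beta> y - \<beta> x \<le> R}" and z: "z \<in> S" "y \<noteq> z" "A y z > 0"
    then obtain R where R: "\<And>\<beta>. \<beta>\<in>L \<Longrightarrow> \<beta> y - \<beta> x \<le> R" by auto
    have "\<beta> z - \<beta> x \<le> R + c / A y z" if "\<beta> \<in> L" for \<beta>
    proof -
      have "A y z * exp (\<beta> z - \<beta> y) \<le> c" using that y z by (auto simp: L_def)
      then have "exp (\<beta> z - \<beta> y) \<le> c / A y z" using z by (simp add: field_simps)
      then have "\<beta> z - \<beta> y \<le> c / A y z"
        using exp_ge_add_one_self[of "\<beta> z - \<beta> y"] by linarith
      with R[OF that] show ?thesis by linarith
    qed
    with z show "z \<in> {y\<in>S. \<exists>R. \<forall>\<beta>\<in>L. \<beta> y - \<beta> x \<le> R}" by blast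
  qed auto
  then have "\<forall>x\<in>S. \<forall>y\<in>S. \<exists>R. \<forall>\<beta>\<in>L. \<beta> y - \<beta> x \<le> R" by blast
  then obtain R where R: "\<And>x y \<beta>. x \<in> S \<Longrightarrow> y \<in> S \<Longrightarrow> \<beta> \<in> L \<Longrightarrow> \<beta> y - \<beta> x \<le> R x y"
    by metis
  define B where "B = (\<Sum>x\<in>S. \<Sum>y\<in>S. \<bar>R x y\<bar>)"
  have RB: "\<bar>R x y\<bar> \<le> B" if "x \<in> S" "y \<in> S" for x y
  proof -
    have "\<bar>R x y\<bar> \<le> (\<Sum>y\<in>S. \<bar>R x y\<bar>)" using that fin by (intro member_le_sum) auto
    also have "\<dots> \<le> B" unfolding B_def using that fin
      by (intro member_le_sum[of x S "\<lambda>x. \<Sum>y\<in>S. \<bar>R x y\<bar>"]) (auto intro: sum_nonneg)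
    finally show ?thesis .
  qed
  have "\<bar>\<beta> x\<bar> \<le> B" if "\<beta> \<in> L" "x \<in> S" for \<beta> x
  proof -
    have n: "real (card S) > 0" using fin nonempty by (simp add: card_gt_0_iff)
    have s: "(\<Sum>y\<in>S. \<beta> y) = 0" using that by (simp add: L_def zero_sum_def)
    have d: "\<bar>\<beta> x - \<beta> y\<bar> \<le> B" if "y \<in> S" for y
      using R[OF that \<open>x \<in> S\<close> \<open>\<beta> \<in> L\<close>] R[OF \<open>x \<in> S\<close> that \<open>\<beta> \<in> L\<close>] RB[OF that \<open>x \<in> S\<close>] RB[OF \<open>x \<in> S\<close> that]
      by linarith
    \<comment> \<open>Since the values of \<open>\<beta>\<close> sum to 0, \<open>\<beta> x\<close>
      is the average of its differences to all sites.\<close>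
    have "card S * \<beta> x = (\<Sum>y\<in>S. \<beta> x - \<beta> y)" using s by (simp add: sum_subtractf)
    then have "card S * \<bar>\<beta> x\<bar> = \<bar>\<Sum>y\<in>S. \<beta> x - \<beta> y\<bar>" by (metis abs_mult abs_of_nat)
    also have "\<dots> \<le> (\<Sum>y\<in>S. \<bar>\<beta> x - \<beta> y\<bar>)" by (rule sum_abs)
    also have "\<dots> \<le> card S * B" using d by (intro sum_bounded_above) auto
    finally show ?thesis using n by simp
  qed
  then show ?thesis unfolding L_def by blast
qed

text \<open>The direct method: \<open>le\<close> is coercivity up to the constant \<open>c\<close>,
  so the sublevel set through a reference potential lies in a compact set, and a minimiser there is
  global.\<close>

lemma attains_min:
  assumes cont: "continuous_on UNIV f"
    and le: "\<And>\<beta> x y. \<beta> \<in> zero_sum S \<Longrightarrow> x \<in> S \<Longrightarrow> y \<in> S \<Longrightarrow> x \<noteq> y \<Longrightarrow>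
        A x y * exp (\<beta> y - \<beta> x) \<le> f \<beta> + c"
  shows "\<exists>\<beta>\<in>zero_sum S. \<forall>\<alpha>\<in>zero_sum S. f \<beta> \<le> f \<alpha>"
proof -
  define \<beta>0 :: "'a \<Rightarrow> real" where "\<beta>0 = centre S (\<lambda>_. 0)"
  have \<beta>0: "\<beta>0 \<in> zero_sum S" unfolding \<beta>0_def using fin nonempty by (rule centre_zero_sum)
  obtain R where R: "\<And>\<beta> x. \<beta> \<in> zero_sum S \<Longrightarrow> x \<in> S \<Longrightarrow>
      (\<And>x y. x \<in> S \<Longrightarrow> y \<in> S \<Longrightarrow> x \<noteq> y \<Longrightarrow> A x y * exp (\<beta> y - \<beta> x) \<le> f \<beta>0 + c) \<Longrightarrow> \<bar>\<beta> x\<bar> \<le> R"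
    using sublevel_bounded[of "f \<beta>0 + c"] by blast
  define K where "K = {\<beta> \<in> zero_sum S. \<forall>x\<in>S. \<bar>\<beta> x\<bar> \<le> R}"
  have sub: "\<beta> \<in> K" if "\<beta> \<in> zero_sum S" "f \<beta> \<le> f \<beta>0" for \<beta>
  proof -
    have "A x y * exp (\<beta> y - \<beta> x) \<le> f \<beta>0 + c" if "x \<in> S" "y \<in> S" "x \<noteq> y" for x y
      using le[OF \<open>\<beta> \<in> _\<close> that] \<open>f \<beta> \<le> _\<close> by linarith
    then show ?thesis unfolding K_def using that R by blast
  qed
  have "K \<noteq> {}" using sub[OF \<beta>0] by auto
  moreover have "compact K" unfolding K_def by (rule compact_zero_sum_bounded)
  ultimately obtain \<beta> where \<beta>: "\<beta> \<in> K" "\<And>\<alpha>. \<alpha> \<in> K \<Longrightarrow> f \<beta> \<le> f \<alpha>"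
    using continuous_attains_inf[of K f] continuous_on_subset[OF cont] by blast
  have "f \<beta> \<le> f \<alpha>" if "\<alpha> \<in> zero_sum S" for \<alpha>
    using \<beta>(2)[OF sub[OF that]] \<beta>(2)[OF sub[OF \<beta>0]] by linarith
  with \<beta> show ?thesis unfolding K_def by blast
qed

text \<open>Collatz-Wielandt: at a positive minimiser of \<open>Max\<^sub>x (A u) x / u x\<close> with the fewest equality
  sites, equality holds everywhere. Otherwise lower \<open>u y\<close> slightly at a strict site \<open>y\<close> that is a
  neighbour of an equality site, which then becomes strict.\<close>

lemma perron:
  "\<exists>\<mu> u. (\<forall>x\<in>S. u x > 0) \<and> (\<forall>x\<in>S. (\<Sum>y\<in>S. A x y * u y) = \<mu> * u x)"
proof -
  \<comment> \<open>With \<open>u x = exp (\<beta> x)\<close> this is the Collatz-Wielandt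
    functional. Rescaling \<open>u\<close> adds a constant to \<open>\<beta>\<close>, so
    \<open>zero_sum S\<close> represents all positive vectors up to scale.\<close>
  define f where "f \<beta> = Max ((\<lambda>x. \<Sum>y\<in>S. A x y * exp (\<beta> y - \<beta> x)) ` S)" for \<beta> :: "'a \<Rightarrow> real"
  \<comment> \<open>Absorbs the diagonal, whose entries may have either sign.\<close>
  define c where "c = (\<Sum>x\<in>S. \<bar>A x x\<bar>)"
  have "\<exists>\<beta>\<in>zero_sum S. \<forall>\<alpha>\<in>zero_sum S. f \<beta> \<le> f \<alpha>"
  proof (rule attains_min)
    show "continuous_on UNIV f" unfolding f_def using fin nonempty
      by (intro continuous_on_Max_image) (auto intro!: continuous_intros)
  next
    fix \<beta> x y assume xy: "x \<in> S" "y \<in> S" "x \<noteq> y"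
    have "A x y * exp (\<beta> y - \<beta> x) \<le> (\<Sum>y\<in>S-{x}. A x y * exp (\<beta> y - \<beta> x))"
      using xy fin offdiag by (intro member_le_sum) auto
    also have "\<dots> = (\<Sum>y\<in>S. A x y * exp (\<beta> y - \<beta> x)) - A x x"
      using xy fin by (simp add: sum_diff1)
    also have "\<dots> \<le> f \<beta> - A x x" unfolding f_def using xy fin by simp
    also have "\<bar>A x x\<bar> \<le> c" unfolding c_def using xy fin
      by (intro member_le_sum[of x S "\<lambda>x. \<bar>A x x\<bar>"]) auto
    then have "f \<beta> - A x x \<le> f \<beta> + c" by linarith
    finally show "A x y * exp (\<beta> y - \<beta> x) \<le> f \<beta> + c" .
  qed
  then obtain \<beta> where \<beta>: "\<And>\<alpha>. \<alpha> \<in> zero_sum S \<Longrightarrow> f \<beta> \<le> f \<alpha>" by blast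
  define \<mu> where "\<mu> = f \<beta>"
  \<comment> \<open>\<open>P\<close> describes the positive supersolutions at level
    \<open>\<mu>\<close>, and \<open>E\<close> their equality sites.\<close>
  define P where "P u \<longleftrightarrow> (\<forall>x\<in>S. u x > 0 \<and> (\<Sum>y\<in>S. A x y * u y) \<le> \<mu> * u x)" for u
  define E where "E u = {x\<in>S. (\<Sum>y\<in>S. A x y * u y) = \<mu> * u x}" for u
  have quot: "(\<Sum>y\<in>S. A x y * exp (\<alpha> y - \<alpha> x)) = (\<Sum>y\<in>S. A x y * exp (\<alpha> y)) / exp (\<alpha> x)" for x \<alpha>
    by (simp add: exp_diff sum_divide_distrib)
  have "P (\<lambda>x. exp (\<beta> x))" unfolding P_def
  proof (intro ballI conjI)
    fix x assume "x \<in> S"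
    then have "(\<Sum>y\<in>S. A x y * exp (\<beta> y - \<beta> x)) \<le> \<mu>"
      unfolding \<mu>_def f_def using fin by simp
    then show "(\<Sum>y\<in>S. A x y * exp (\<beta> y)) \<le> \<mu> * exp (\<beta> x)"
      unfolding quot by (simp add: divide_le_eq)
  qed simp
  then obtain u where u: "P u" and least: "\<And>v. P v \<Longrightarrow> card (E u) \<le> card (E v)"
    using ex_has_least_nat[of P "\<lambda>x. exp (\<beta> x)" "\<lambda>v. card (E v)"] by blast
  \<comment> \<open>Without an equality site all quotients of \<open>v\<close> would lie below
    \<open>\<mu>\<close>, and the centred logarithm of \<open>v\<close> would beat the minimiser
    \<open>\<beta>\<close>.\<close>
  have E_nonempty: "E v \<noteq> {}" if "P v" for v
  proof -
    define \<alpha> where "\<alpha> = (\<lambda>x. ln (v x))"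
    have "\<mu> \<le> f (centre S \<alpha>)" unfolding \<mu>_def using fin nonempty by (intro \<beta> centre_zero_sum)
    moreover have "f (centre S \<alpha>) \<in> (\<lambda>x. \<Sum>y\<in>S. A x y * exp (centre S \<alpha> y - centre S \<alpha> x)) ` S"
      unfolding f_def using fin nonempty by (intro Max_in) auto
    ultimately obtain x where x: "x \<in> S"
      and "\<mu> \<le> (\<Sum>y\<in>S. A x y * exp (centre S \<alpha> y - centre S \<alpha> x))"
      by auto
    note this(2)
    also have "(\<Sum>y\<in>S. A x y * exp (centre S \<alpha> y - centre S \<alpha> x)) = (\<Sum>y\<in>S. A x y * exp (\<alpha> y - \<alpha> x))"
      using x by (simp add: centre_diff)
    also have "\<dots> = (\<Sum>y\<in>S. A x y * v y) / v x"
      unfolding quot using that x by (simp add: \<alpha>_def P_def)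
    finally have "\<mu> * v x \<le> (\<Sum>y\<in>S. A x y * v y)"
      using that x by (simp add: P_def le_divide_eq)
    with x that show ?thesis by (force simp: E_def P_def)
  qed
  have "E u = S"
  proof (rule ccontr)
    assume "E u \<noteq> S"
    then obtain x y where xy: "x \<in> E u" "y \<in> S" "y \<notin> E u" "x \<noteq> y" "A x y > 0"
      using irreducible[of "E u"] E_nonempty[OF u] unfolding E_def by blast
    define d where "d = \<mu> * u y - (\<Sum>z\<in>S. A y z * u z)"
    have d: "d > 0" using u xy by (force simp: P_def E_def d_def)
    have uy: "u y > 0" using u xy by (simp add: P_def)
    \<comment> \<open>The bound \<open>\<epsilon> < u y\<close> will keep the lowered vector
      positive, and \<open>\<epsilon> * k \<le> d / 2\<close> will keep \<open>y\<close> strict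
      whatever the sign of \<open>A y y - \<mu>\<close>. The summand 1 makes \<open>k\<close>
      positive.\<close>
    define k where "k = 1 + \<bar>A y y - \<mu>\<bar>"
    have k: "k > 0" unfolding k_def by linarith
    define \<epsilon> where "\<epsilon> = min (u y / 2) (d / (2 * k))"
    have "d / (2 * k) > 0" using d k by simp
    then have \<epsilon>: "\<epsilon> > 0" "\<epsilon> < u y" using uy unfolding \<epsilon>_def by linarith+
    have "\<epsilon> * \<bar>A y y - \<mu>\<bar> \<le> \<epsilon> * k" using \<epsilon> by (simp add: k_def)
    also have "\<dots> \<le> d / (2 * k) * k"
      using k by (intro mult_right_mono) (auto simp: \<epsilon>_def)
    also have "\<dots> = d / 2" using k by simp
    finally have "\<epsilon> * \<bar>A y y - \<mu>\<bar> < d" using d by linarith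
    moreover have "\<epsilon> * (\<mu> - A y y) \<le> \<epsilon> * \<bar>A y y - \<mu>\<bar>" using \<epsilon> by simp
    ultimately have \<epsilon>d: "\<epsilon> * (\<mu> - A y y) < d" by linarith
    define w where "w = u(y := u y - \<epsilon>)"
    have Aw: "(\<Sum>y\<in>S. A z y * w y) = (\<Sum>y\<in>S. A z y * u y) - \<epsilon> * A z y" for z
      using xy(2) fin by (simp add: w_def sum.remove[of S y] algebra_simps)
    have strict: "(\<Sum>z\<in>S. A y z * w z) < \<mu> * w y"
      using \<epsilon>d unfolding Aw d_def by (simp add: w_def algebra_simps)
    have other: "(\<Sum>y\<in>S. A z y * w y) \<le> (\<Sum>y\<in>S. A z y * u y)" "w z = u z"
      if "z \<in> S" "z \<noteq> y" for z
      using that xy \<epsilon> offdiag[of z y] unfolding Aw by (simp_all add: w_def)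
    have "P w" unfolding P_def
    proof
      fix z assume z: "z \<in> S"
      show "0 < w z \<and> (\<Sum>y\<in>S. A z y * w y) \<le> \<mu> * w z"
      proof (cases "z = y")
        case True
        with strict \<epsilon> show ?thesis by (simp add: w_def)
      next
        case False
        with other[OF z] u z show ?thesis unfolding P_def by fastforce
      qed
    qed
    \<comment> \<open>The site \<open>y\<close> stays strict, and \<open>x\<close> becomes strict
      because \<open>A x y > 0\<close>. Elsewhere the row sum does not grow while \<open>w\<close>
      agrees with \<open>u\<close>, so no equality site is gained.\<close>
    have "E w \<subseteq> E u - {x}"
    proof
      fix z assume z: "z \<in> E w"
      have "z \<noteq> y" using strict z by (auto simp: E_def)
      have "z \<noteq> x"
      proof
        assume "z = x"
        have "(\<Sum>y\<in>S. A x y * w y) < (\<Sum>y\<in>S. A x y * u y)" using \<epsilon> xy by (simp add: Aw)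
        with z \<open>z = x\<close> xy show False using other(2)[of x] by (auto simp: E_def)
      qed
      moreover have "z \<in> E u"
        using z u other[of z] \<open>z \<noteq> y\<close> by (force simp: E_def P_def)
      ultimately show "z \<in> E u - {x}" by simp
    qed
    then have "card (E w) < card (E u)"
      using xy fin by (intro psubset_card_mono) (auto simp: E_def)
    with least[OF \<open>P w\<close>] show False by simp
  qed
  with u show ?thesis unfolding P_def E_def by blast
qed

end

section \<open>Inequalities for weights with equal row and column sums\<close>

text \<open>Expand the nonnegative sum of \<open>W x y * (b x - b y)\<^sup>2\<close>: both square
  terms give the right-hand side because the two marginals agree. Diagonal terms vanish, so only
  off-diagonal signs enter.\<close>

lemma weighted_square_bound:
  fixes W :: "'a \<Rightarrow> 'a \<Rightarrow> real"
  assumes nonneg: "\<And>x y. x \<in> S \<Longrightarrow> y \<in> S \<Longrightarrow> x \<noteq> y \<Longrightarrow> W x y \<ge> 0"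
    and row: "\<And>x. x \<in> S \<Longrightarrow> (\<Sum>y\<in>S. W x y) = d x" and col: "\<And>y. y \<in> S \<Longrightarrow> (\<Sum>x\<in>S. W x y) = d y"
  shows "(\<Sum>x\<in>S. \<Sum>y\<in>S. W x y * b x * b y) \<le> (\<Sum>x\<in>S. d x * (b x)\<^sup>2)"
proof -
  have r: "(\<Sum>x\<in>S. \<Sum>y\<in>S. W x y * (b x)\<^sup>2) = (\<Sum>x\<in>S. d x * (b x)\<^sup>2)"
    using row by (simp flip: sum_distrib_right)
  have c: "(\<Sum>x\<in>S. \<Sum>y\<in>S. W x y * (b y)\<^sup>2) = (\<Sum>x\<in>S. d x * (b x)\<^sup>2)"
    using col by (subst sum.swap) (simp flip: sum_distrib_right)
  have "0 \<le> (\<Sum>x\<in>S. \<Sum>y\<in>S. W x y * (b x - b y)\<^sup>2)"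
  proof (intro sum_nonneg)
    fix x y assume "x \<in> S" "y \<in> S"
    then show "0 \<le> W x y * (b x - b y)\<^sup>2" using nonneg[of x y] by (cases "x = y") auto
  qed
  also have "\<dots> = (\<Sum>x\<in>S. \<Sum>y\<in>S. W x y * (b x)\<^sup>2) + (\<Sum>x\<in>S. \<Sum>y\<in>S. W x y * (b y)\<^sup>2)
      - 2 * (\<Sum>x\<in>S. \<Sum>y\<in>S. W x y * b x * b y)"
    by (simp add: power2_diff algebra_simps sum_distrib_left sum.distrib sum_subtractf)
  finally show ?thesis using r c by simp
qed

text \<open>Replace \<open>exp t\<close> by its tangent \<open>1 + t\<close>; the linear terms
  cancel because the two marginals agree. On the diagonal the exponent is 0 and the estimate is an
  equality.\<close>

lemma weighted_exp_bound:
  fixes W :: "'a \<Rightarrow> 'a \<Rightarrow> real"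
  assumes nonneg: "\<And>x y. x \<in> S \<Longrightarrow> y \<in> S \<Longrightarrow> x \<noteq> y \<Longrightarrow> W x y \<ge> 0"
    and row: "\<And>x. x \<in> S \<Longrightarrow> (\<Sum>y\<in>S. W x y) = d x" and col: "\<And>y. y \<in> S \<Longrightarrow> (\<Sum>x\<in>S. W x y) = d y"
  shows "(\<Sum>x\<in>S. d x) \<le> (\<Sum>x\<in>S. \<Sum>y\<in>S. W x y * exp (\<delta> y - \<delta> x))"
proof -
  have r: "(\<Sum>x\<in>S. \<Sum>y\<in>S. W x y * \<delta> x) = (\<Sum>x\<in>S. d x * \<delta> x)"
    using row by (simp flip: sum_distrib_right)
  have c: "(\<Sum>x\<in>S. \<Sum>y\<in>S. W x y * \<delta> y) = (\<Sum>x\<in>S. d x * \<delta> x)"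
    using col by (subst sum.swap) (simp flip: sum_distrib_right)
  have "(\<Sum>x\<in>S. d x) = (\<Sum>x\<in>S. \<Sum>y\<in>S. W x y * (1 + (\<delta> y - \<delta> x)))"
    using r c by (simp add: algebra_simps sum.distrib sum_subtractf row)
  also have "\<dots> \<le> (\<Sum>x\<in>S. \<Sum>y\<in>S. W x y * exp (\<delta> y - \<delta> x))"
  proof (intro sum_mono)
    fix x y assume "x \<in> S" "y \<in> S"
    then show "W x y * (1 + (\<delta> y - \<delta> x)) \<le> W x y * exp (\<delta> y - \<delta> x)"
      using nonneg[of x y] exp_ge_add_one_self[of "\<delta> y - \<delta> x"]
      by (cases "x = y") (auto intro: mult_left_mono)
  qed
  finally show ?thesis .
qed

section \<open>Energy, symmetrised kernel and saddle point\<close>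

definition unit_amplitudes :: "'a set \<Rightarrow> ('a \<Rightarrow> real) set" where
  "unit_amplitudes S = {a \<in> S \<rightarrow>\<^sub>E {0<..}. (\<Sum>x\<in>S. (a x)\<^sup>2) = 1}"

context irreducible_metzler
begin

text \<open>The quadratic form at \<open>a\<close> of \<open>A\<close> conjugated by the diagonal
  matrix with entries \<open>exp (\<beta> x)\<close>; for the torus kernel it is the free
  energy.\<close>

definition energy :: "('a \<Rightarrow> real) \<Rightarrow> ('a \<Rightarrow> real) \<Rightarrow> real" where
  "energy a \<beta> = (\<Sum>x\<in>S. \<Sum>y\<in>S. A x y * exp (\<beta> y - \<beta> x) * a x * a y)"

text \<open>The entries of the matrix H of the theorem, for an abstract kernel.\<close>

definition sym_part :: "('a \<Rightarrow> real) \<Rightarrow> 'a \<Rightarrow> 'a \<Rightarrow> real" where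
  "sym_part \<beta> x y = (A x y * exp (\<beta> y - \<beta> x) + A y x * exp (\<beta> x - \<beta> y)) / 2"

lemma irreducible_metzler_sym_part: "irreducible_metzler S (sym_part \<beta>)"
proof (rule irreducible_metzler_mono)
  fix x y assume "x \<in> S" "y \<in> S" "x \<noteq> y"
  then show "sym_part \<beta> x y \<ge> 0" using offdiag[of x y] offdiag[of y x] by (simp add: sym_part_def)
next
  fix x y assume "x \<in> S" "y \<in> S" "x \<noteq> y" "A x y > 0"
  then show "sym_part \<beta> x y > 0" using offdiag[of y x]
    by (auto simp: sym_part_def intro: add_pos_nonneg)
qed

text \<open>A quadratic form sees only the symmetric part: average it with its copy in which the
  summation indices are swapped.\<close>

lemma energy_sym_part: "energy a \<beta> = (\<Sum>x\<in>S. \<Sum>y\<in>S. sym_part \<beta> x y * a x * a y)"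
proof -
  have "energy a \<beta> = (\<Sum>x\<in>S. \<Sum>y\<in>S. A y x * exp (\<beta> x - \<beta> y) * a x * a y)"
    unfolding energy_def by (subst sum.swap) (simp add: mult_ac)
  then have "2 * energy a \<beta> = energy a \<beta> + (\<Sum>x\<in>S. \<Sum>y\<in>S. A y x * exp (\<beta> x - \<beta> y) * a x * a y)"
    by simp
  also have "\<dots> = 2 * (\<Sum>x\<in>S. \<Sum>y\<in>S. sym_part \<beta> x y * a x * a y)"
    unfolding energy_def sum.distrib[symmetric] sum_distrib_left
    by (intro sum.cong refl) (simp add: sym_part_def distrib_right)
  finally show ?thesis by simp
qed

text \<open>The normalised Perron vector \<open>a\<close> of the symmetrised kernel makes
  \<open>W x y = a x * sym_part \<beta> x y * a y\<close> symmetric with marginals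
  \<open>\<mu> * (a x)\<^sup>2\<close>. Applying \<open>weighted_square_bound\<close> to the ratios
  \<open>b x / a x\<close> gives the Rayleigh bound for all real vectors \<open>b\<close>.\<close>

lemma sym_part_top_eigenvector:
  "\<exists>\<mu>. \<exists>a\<in>unit_amplitudes S. (\<forall>x\<in>S. (\<Sum>y\<in>S. sym_part \<beta> x y * a y) = \<mu> * a x)
      \<and> energy a \<beta> = \<mu> \<and> (\<forall>b. energy b \<beta> \<le> \<mu> * (\<Sum>x\<in>S. (b x)\<^sup>2))"
proof -
  interpret H: irreducible_metzler S "sym_part \<beta>" by (rule irreducible_metzler_sym_part)
  obtain \<mu> w where w: "\<And>x. x \<in> S \<Longrightarrow> w x > 0"
    and Hw: "\<And>x. x \<in> S \<Longrightarrow> (\<Sum>y\<in>S. sym_part \<beta> x y * w y) = \<mu> * w x"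
    using H.perron by blast
  define Z where "Z = (\<Sum>x\<in>S. (w x)\<^sup>2)"
  have "Z > 0" unfolding Z_def using fin nonempty w by (intro sum_pos zero_less_power) auto
  define a where "a = (\<lambda>x\<in>S. w x / sqrt Z)"
  have a: "a \<in> unit_amplitudes S"
    using w \<open>Z > 0\<close>
    by (auto simp: a_def unit_amplitudes_def power_divide simp flip: sum_divide_distrib Z_def)
  have Ha: "(\<Sum>y\<in>S. sym_part \<beta> x y * a y) = \<mu> * a x" if "x \<in> S" for x
    using Hw[OF that] that by (simp add: a_def flip: sum_divide_distrib)
  have pos: "a x > 0" if "x \<in> S" for x using a that by (auto simp: unit_amplitudes_def)
  then have nz: "a x \<noteq> 0" if "x \<in> S" for x using that by force
  define W where "W x y = a x * sym_part \<beta> x y * a y" for x y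
  have sym: "W x y = W y x" for x y by (simp add: W_def sym_part_def)
  have row: "(\<Sum>y\<in>S. W x y) = \<mu> * (a x)\<^sup>2" if "x \<in> S" for x
    using Ha[OF that] by (simp add: W_def mult.assoc power2_eq_square flip: sum_distrib_left)
  have bound: "energy b \<beta> \<le> \<mu> * (\<Sum>x\<in>S. (b x)\<^sup>2)" for b
  proof -
    have "energy b \<beta> = (\<Sum>x\<in>S. \<Sum>y\<in>S. W x y * (b x / a x) * (b y / a y))"
      unfolding energy_sym_part W_def using nz by (intro sum.cong) auto
    also have "\<dots> \<le> (\<Sum>x\<in>S. \<mu> * (a x)\<^sup>2 * (b x / a x)\<^sup>2)"
    proof (rule weighted_square_bound)
      fix x y assume "x \<in> S" "y \<in> S" "x \<noteq> y"
      then show "W x y \<ge> 0" using pos[of x] pos[of y] H.offdiag[of x y] by (simp add: W_def)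
    next
      show "(\<Sum>x\<in>S. W x y) = \<mu> * (a y)\<^sup>2" if "y \<in> S" for y
        using row[OF that] by (simp add: sym[of _ y])
    qed (rule row)
    also have "\<dots> = \<mu> * (\<Sum>x\<in>S. (b x)\<^sup>2)"
      using nz by (auto simp: sum_distrib_left power_divide intro!: sum.cong)
    finally show ?thesis .
  qed
  have "energy a \<beta> = (\<Sum>x\<in>S. \<Sum>y\<in>S. W x y)" by (simp add: energy_sym_part W_def mult_ac)
  also have "\<dots> = \<mu>" using a by (simp add: row unit_amplitudes_def flip: sum_distrib_left)
  finally show ?thesis using a Ha bound by blast
qed

text \<open>Both energy bounds come from the weights \<open>W\<close> formed with the left and right
  Perron vectors. The eigenvector \<open>u\<close> and the clause on complex \<open>k\<close> are
  carried along to identify \<open>\<mu>\<close> as the spectral bound.\<close>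

lemma saddle_point:
  "\<exists>\<mu> u. \<exists>a\<in>unit_amplitudes S. \<exists>\<beta>\<in>zero_sum S.
      (\<forall>x\<in>S. u x > 0 \<and> (\<Sum>y\<in>S. A x y * u y) = \<mu> * u x)
      \<and> (\<forall>b. energy b \<beta> \<le> \<mu> * (\<Sum>x\<in>S. (b x)\<^sup>2)) \<and> (\<forall>\<alpha>. \<mu> \<le> energy a \<alpha>)
      \<and> (\<forall>k::complex. \<forall>w. (\<exists>x\<in>S. w x \<noteq> 0) \<longrightarrow>
          (\<forall>x\<in>S. (\<Sum>y\<in>S. complex_of_real (A x y) * w y) = k * w x) \<longrightarrow> Re k \<le> \<mu>)"
proof -
  interpret T: irreducible_metzler S "\<lambda>x y. A y x" by (rule irreducible_metzler_transpose)
  obtain \<mu> u where u: "\<And>x. x \<in> S \<Longrightarrow> u x > 0"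
    and Au: "\<And>x. x \<in> S \<Longrightarrow> (\<Sum>y\<in>S. A x y * u y) = \<mu> * u x"
    using perron by blast
  obtain \<mu>' v where v: "\<And>x. x \<in> S \<Longrightarrow> v x > 0"
    and Av': "\<And>x. x \<in> S \<Longrightarrow> (\<Sum>y\<in>S. A y x * v y) = \<mu>' * v x"
    using T.perron by blast
  have left: "(\<Sum>x\<in>S. v x * (\<Sum>y\<in>S. A x y * g y)) = \<mu>' * (\<Sum>x\<in>S. v x * g x)" for g
  proof -
    have "(\<Sum>x\<in>S. v x * (\<Sum>y\<in>S. A x y * g y)) = (\<Sum>y\<in>S. (\<Sum>x\<in>S. A x y * v x) * g y)"
      unfolding sum_distrib_left sum_distrib_right by (subst sum.swap) (simp add: mult_ac)
    also have "\<dots> = \<mu>' * (\<Sum>x\<in>S. v x * g x)" by (simp add: Av' sum_distrib_left mult.assoc)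
    finally show ?thesis .
  qed
  define Z where "Z = (\<Sum>x\<in>S. v x * u x)"
  have Z: "Z > 0" unfolding Z_def using fin nonempty u v by (intro sum_pos) auto
  \<comment> \<open>Pairing \<open>A u\<close> with \<open>v\<close> in two ways identifies the left
    and right Perron eigenvalues, as \<open>Z > 0\<close>.\<close>
  have "\<mu> * Z = (\<Sum>x\<in>S. v x * (\<Sum>y\<in>S. A x y * u y))"
    unfolding Z_def sum_distrib_left[of \<mu>] by (intro sum.cong refl) (simp add: Au)
  also have "\<dots> = \<mu>' * Z" unfolding left Z_def ..
  finally have eq: "\<mu>' = \<mu>" using Z by simp
  note Av = Av'[unfolded eq] and left = left[unfolded eq]

  \<comment> \<open>The moduli of a complex eigenvector satisfy
    \<open>Re k * cmod (w x) \<le> (\<Sum>y\<in>S. A x y * cmod (w y))\<close>; pairing with the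
    positive left eigenvector \<open>v\<close> gives the claim.\<close>
  have re: "Re k \<le> \<mu>" if nz: "\<exists>x\<in>S. w x \<noteq> 0"
    and ev: "\<And>x. x \<in> S \<Longrightarrow> (\<Sum>y\<in>S. complex_of_real (A x y) * w y) = k * w x" for k w
  proof -
    have *: "Re k * cmod (w x) \<le> (\<Sum>y\<in>S. A x y * cmod (w y))" if x: "x \<in> S" for x
    proof -
      \<comment> \<open>The diagonal is moved to the left before taking moduli, since only
        off-diagonal entries are known to be nonnegative.\<close>
      have "(k - A x x) * w x = (\<Sum>y\<in>S-{x}. complex_of_real (A x y) * w y)"
        using ev[OF x] x fin by (simp add: sum_diff1 algebra_simps)
      then have "cmod (k - A x x) * cmod (w x) \<le> (\<Sum>y\<in>S-{x}. cmod (complex_of_real (A x y) * w y))"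
        by (metis norm_mult norm_sum)
      also have "\<dots> = (\<Sum>y\<in>S-{x}. A x y * cmod (w y))"
        using offdiag[OF x] by (intro sum.cong) (auto simp: norm_mult)
      also have "\<dots> = (\<Sum>y\<in>S. A x y * cmod (w y)) - A x x * cmod (w x)"
        using x fin by (simp add: sum_diff1)
      finally have "cmod (k - A x x) * cmod (w x) + A x x * cmod (w x) \<le> (\<Sum>y\<in>S. A x y * cmod (w y))"
        by simp
      moreover have "(Re k - A x x) * cmod (w x) \<le> cmod (k - A x x) * cmod (w x)"
        using complex_Re_le_cmod[of "k - A x x"] by (intro mult_right_mono) auto
      ultimately show ?thesis by (simp add: algebra_simps)
    qed
    obtain x where "x \<in> S" "w x \<noteq> 0" using nz by blast
    then have "(\<Sum>x\<in>S. v x * cmod (w x)) > 0"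
      using v fin by (intro sum_pos2[of S x]) (auto intro!: mult_nonneg_nonneg intro: less_imp_le)
    moreover have "Re k * (\<Sum>x\<in>S. v x * cmod (w x)) \<le> \<mu> * (\<Sum>x\<in>S. v x * cmod (w x))"
      unfolding left[symmetric] sum_distrib_left[of "Re k"]
    proof (intro sum_mono)
      fix x assume "x \<in> S"
      with *[of x] v[of x] show "Re k * (v x * cmod (w x)) \<le> v x * (\<Sum>y\<in>S. A x y * cmod (w y))"
        using mult_left_mono[of "Re k * cmod (w x)" _ "v x"] by (simp add: mult_ac)
    qed
    ultimately show ?thesis by simp
  qed

  define a where "a = (\<lambda>x\<in>S. sqrt (v x * u x / Z))"
  define \<beta> where "\<beta> = centre S (\<lambda>x. ln (u x / v x) / 2)"
  have a2: "(a x)\<^sup>2 = v x * u x / Z" if "x \<in> S" for x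
    using u[OF that] v[OF that] Z that by (simp add: a_def)
  have a: "a \<in> unit_amplitudes S"
    using u v Z by (simp add: unit_amplitudes_def a2 flip: sum_divide_distrib Z_def) (auto simp: a_def)
  have pos: "a x > 0" if "x \<in> S" for x using a that by (auto simp: unit_amplitudes_def)
  then have nz: "a x \<noteq> 0" if "x \<in> S" for x using that by force
  have \<beta>: "\<beta> \<in> zero_sum S" unfolding \<beta>_def using fin nonempty by (rule centre_zero_sum)

  define W where "W x y = v x * A x y * u y / Z" for x y
  have row: "(\<Sum>y\<in>S. W x y) = \<mu> * (a x)\<^sup>2" if "x \<in> S" for x
    using Au[OF that] that
    by (simp add: W_def a2 mult.assoc flip: sum_divide_distrib sum_distrib_left)
  have col: "(\<Sum>x\<in>S. W x y) = \<mu> * (a y)\<^sup>2" if "y \<in> S" for y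
  proof -
    have "(\<Sum>x\<in>S. W x y) = (\<Sum>x\<in>S. A x y * v x) * u y / Z"
      unfolding W_def sum_distrib_right sum_divide_distrib by (intro sum.cong refl) simp
    then show ?thesis using that by (simp add: Av a2)
  qed
  have nonneg: "W x y \<ge> 0" if "x \<in> S" "y \<in> S" "x \<noteq> y" for x y
    using offdiag[OF that] u[of y] v[of x] that Z by (simp add: W_def)
  \<comment> \<open>Here the choice of \<open>a\<close> and \<open>\<beta>\<close> pays off: the
    square roots recombine to \<open>v x * u y / Z\<close>.\<close>
  have W: "W x y = A x y * exp (\<beta> y - \<beta> x) * a x * a y" if "x \<in> S" "y \<in> S" for x y
  proof -
    have half: "exp (ln t / 2) = sqrt t" if "t > 0" for t :: real
      using that by (intro real_sqrt_unique[symmetric]) (simp_all add: power2_eq_square flip: exp_add)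
    have "exp (\<beta> y - \<beta> x) = sqrt (u y / v y) / sqrt (u x / v x)"
      using that u v
      by (simp add: \<beta>_def centre_diff exp_diff half)
    then have "exp (\<beta> y - \<beta> x) * (a x * a y) = (sqrt (u y / v y) * sqrt (v y * u y / Z)) * (sqrt (v x * u x / Z) / sqrt (u x / v x))"
      using that by (simp add: a_def)
    also have "sqrt (u y / v y) * sqrt (v y * u y / Z) = u y / sqrt Z"
      using u[of y] v[of y] that by (simp flip: real_sqrt_mult) (simp add: real_sqrt_divide real_sqrt_mult)
    also have "sqrt (v x * u x / Z) / sqrt (u x / v x) = v x / sqrt Z"
      using u[of x] v[of x] that by (simp flip: real_sqrt_divide) (simp add: real_sqrt_divide real_sqrt_mult)
    finally have "exp (\<beta> y - \<beta> x) * (a x * a y) = v x * u y / Z" using Z by simp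
    then have "A x y * (exp (\<beta> y - \<beta> x) * (a x * a y)) = W x y" by (simp add: W_def)
    then show ?thesis by (simp add: mult.assoc)
  qed
  have upper: "energy b \<beta> \<le> \<mu> * (\<Sum>x\<in>S. (b x)\<^sup>2)" for b
  proof -
    have "energy b \<beta> = (\<Sum>x\<in>S. \<Sum>y\<in>S. W x y * (b x / a x) * (b y / a y))"
      unfolding energy_def using nz by (intro sum.cong) (auto simp: W)
    also have "\<dots> \<le> (\<Sum>x\<in>S. \<mu> * (a x)\<^sup>2 * (b x / a x)\<^sup>2)"
      by (rule weighted_square_bound) (use nonneg row col in auto)
    also have "\<dots> = \<mu> * (\<Sum>x\<in>S. (b x)\<^sup>2)"
      using nz by (auto simp: sum_distrib_left power_divide intro!: sum.cong)
    finally show ?thesis .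
  qed
  have lower: "\<mu> \<le> energy a \<alpha>" for \<alpha>
  proof -
    have "\<mu> = (\<Sum>x\<in>S. \<mu> * (a x)\<^sup>2)" using a by (simp add: unit_amplitudes_def flip: sum_distrib_left)
    \<comment> \<open>The exponential of \<open>\<beta>\<close> is already contained in
      \<open>W\<close>, so the bound is applied to the displacement of \<open>\<alpha>\<close> from
      \<open>\<beta>\<close>.\<close>
    also have "\<dots> \<le> (\<Sum>x\<in>S. \<Sum>y\<in>S. W x y * exp ((\<alpha> y - \<beta> y) - (\<alpha> x - \<beta> x)))"
      by (rule weighted_exp_bound) (use nonneg row col in auto)
    also have "\<dots> = energy a \<alpha>"
      unfolding energy_def by (intro sum.cong refl) (simp add: W exp_diff)
    finally show ?thesis .
  qed
  show ?thesis
    by (rule exI[of _ \<mu>], rule exI[of _ u], rule bexI[OF _ a], rule bexI[OF _ \<beta>])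
      (use u Au upper lower re in blast)
qed

text \<open>Positive amplitudes keep the weighted kernel \<open>B\<close> irreducible. Each
  off-diagonal summand is at most the energy minus the diagonal part, which does not depend on
  \<open>\<beta>\<close>; this is the coercivity that \<open>attains_min\<close> asks for.\<close>

lemma energy_attains_min:
  assumes "\<And>x. x \<in> S \<Longrightarrow> a x > 0"
  shows "\<exists>\<beta>\<in>zero_sum S. \<forall>\<alpha>\<in>zero_sum S. energy a \<beta> \<le> energy a \<alpha>"
proof -
  define B where "B x y = A x y * a x * a y" for x y
  interpret B: irreducible_metzler S B
    by (rule irreducible_metzler_mono) (use offdiag assms in \<open>auto simp: B_def less_imp_le\<close>)
  have E: "energy a \<beta> = (\<Sum>x\<in>S. \<Sum>y\<in>S. B x y * exp (\<beta> y - \<beta> x))" for \<beta>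
    by (simp add: energy_def B_def mult_ac)
  show ?thesis
  proof (rule B.attains_min)
    show "continuous_on UNIV (energy a)" unfolding energy_def by (auto intro!: continuous_intros)
  next
    fix \<beta> x y assume xy: "x \<in> S" "y \<in> S" "x \<noteq> y"
    define off where "off x = (\<Sum>y\<in>S-{x}. B x y * exp (\<beta> y - \<beta> x))" for x
    have "B x y * exp (\<beta> y - \<beta> x) \<le> off x"
      unfolding off_def using xy fin B.offdiag by (intro member_le_sum) auto
    also have "\<dots> \<le> (\<Sum>x\<in>S. off x)"
      using xy fin by (intro member_le_sum) (auto simp: off_def intro!: sum_nonneg mult_nonneg_nonneg B.offdiag)
    also have "\<dots> = (\<Sum>x\<in>S. (\<Sum>y\<in>S. B x y * exp (\<beta> y - \<beta> x)) - B x x)"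
      unfolding off_def using fin by (intro sum.cong) (auto simp: sum_diff1)
    also have "\<dots> = energy a \<beta> + - (\<Sum>x\<in>S. B x x)"
      unfolding E by (simp add: sum_subtractf)
    finally show "B x y * exp (\<beta> y - \<beta> x) \<le> energy a \<beta> + - (\<Sum>x\<in>S. B x x)" .
  qed
qed

end

text \<open>The saddle inequalities bound every inner maximum below and every inner minimum above by
  \<open>\<mu>\<close>, with equality at \<open>\<beta>\<close> and \<open>a\<close>.
  \<open>G\<close> is a parameter so that it can be taken to be the largest eigenvalue of the
  symmetrised matrix.\<close>

lemma (in irreducible_metzler) minimax:
  assumes G: "\<And>\<beta>. \<beta> \<in> zero_sum S \<Longrightarrow> has_max (unit_amplitudes S) (\<lambda>a. energy a \<beta>) (G \<beta>)"
    and saddle: "a \<in> unit_amplitudes S" "\<beta> \<in> zero_sum S"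
      "\<And>b. b \<in> unit_amplitudes S \<Longrightarrow> energy b \<beta> \<le> \<mu>" "\<And>\<alpha>. \<mu> \<le> energy a \<alpha>"
  shows "has_min (zero_sum S) G \<mu>"
    and "\<exists>g. (\<forall>b\<in>unit_amplitudes S. has_min (zero_sum S) (energy b) (g b))
             \<and> has_max (unit_amplitudes S) g \<mu>"
proof -
  have ge: "\<mu> \<le> G \<alpha>" if "\<alpha> \<in> zero_sum S" for \<alpha>
    using G[OF that] saddle(1) saddle(4)[of \<alpha>] unfolding has_max_def by force
  moreover have "G \<beta> \<le> \<mu>" using G[OF saddle(2)] saddle(3) unfolding has_max_def by metis
  ultimately show "has_min (zero_sum S) G \<mu>"
    unfolding has_min_def using saddle(2) by (auto intro: antisym)
  have "\<exists>v. has_min (zero_sum S) (energy b) v" if "b \<in> unit_amplitudes S" for b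
    using energy_attains_min[of b] that by (auto simp: has_min_def unit_amplitudes_def)
  then obtain g where g: "\<And>b. b \<in> unit_amplitudes S \<Longrightarrow> has_min (zero_sum S) (energy b) (g b)"
    by metis
  have le: "g b \<le> \<mu>" if "b \<in> unit_amplitudes S" for b
    using g[OF that] saddle(2) saddle(3)[OF that] unfolding has_min_def by force
  moreover have "\<mu> \<le> g a" using g[OF saddle(1)] saddle(4) unfolding has_min_def by metis
  ultimately have "has_max (unit_amplitudes S) g \<mu>"
    unfolding has_max_def using saddle(1) by (auto intro: antisym)
  with g show "\<exists>g. (\<forall>b\<in>unit_amplitudes S. has_min (zero_sum S) (energy b) (g b))
             \<and> has_max (unit_amplitudes S) g \<mu>" by blast
qed

section \<open>Eigenvectors as functions on the enumerated set\<close>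

text \<open>The enumeration \<open>s\<close> is a bijection from positions to \<open>set s\<close>,
  so vectors correspond to functions on \<open>set s\<close>. The field is general to serve both the
  real and the complex spectrum.\<close>

lemma spectrum_indexed_mat:
  fixes B :: "'a \<Rightarrow> 'a \<Rightarrow> 'b::field"
  assumes "distinct s"
  shows "k \<in> spectrum (mat (length s) (length s) (\<lambda>(i, j). B (s ! i) (s ! j))) \<longleftrightarrow>
    (\<exists>w. (\<exists>x\<in>set s. w x \<noteq> 0) \<and> (\<forall>x\<in>set s. (\<Sum>y\<in>set s. B x y * w y) = k * w x))"
    (is "k \<in> spectrum ?M \<longleftrightarrow> ?R")
proof -
  define n where "n = length s"
  have bij: "bij_betw ((!) s) {..<n} (set s)" using assms by (simp add: n_def bij_betw_nth)
  have sums: "(\<Sum>y\<in>set s. f y) = (\<Sum>j<n. f (s ! j))" for f :: "'a \<Rightarrow> 'b"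
    by (simp add: sum.reindex_bij_betw[OF bij])
  have mv: "?M *\<^sub>v vec n (\<lambda>i. w (s ! i)) = k \<cdot>\<^sub>v vec n (\<lambda>i. w (s ! i)) \<longleftrightarrow>
      (\<forall>x\<in>set s. (\<Sum>y\<in>set s. B x y * w y) = k * w x)" for w
    unfolding sums
    by (auto simp: vec_eq_iff n_def[symmetric] scalar_prod_def atLeast0LessThan all_set_conv_all_nth)
  have nz: "vec n (\<lambda>i. w (s ! i)) \<noteq> 0\<^sub>v n \<longleftrightarrow> (\<exists>x\<in>set s. w x \<noteq> 0)" for w :: "'a \<Rightarrow> 'b"
    by (auto simp: vec_eq_iff n_def in_set_conv_nth) (metis nth_mem)
  have surj: "\<exists>w. v = vec n (\<lambda>i. w (s ! i))" if "v \<in> carrier_vec n" for v :: "'b vec"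
  proof
    show "v = vec n (\<lambda>i. (\<lambda>x. v $ the_inv_into {..<n} ((!) s) x) (s ! i))"
      using that bij by (auto simp: vec_eq_iff the_inv_into_f_f bij_betw_def)
  qed
  have "k \<in> spectrum ?M \<longleftrightarrow> (\<exists>v\<in>carrier_vec n. v \<noteq> 0\<^sub>v n \<and> ?M *\<^sub>v v = k \<cdot>\<^sub>v v)"
    by (auto simp: spectrum_def eigenvalue_def eigenvector_def n_def)
  also have "\<dots> \<longleftrightarrow> (\<exists>w. vec n (\<lambda>i. w (s ! i)) \<noteq> 0\<^sub>v n
      \<and> ?M *\<^sub>v vec n (\<lambda>i. w (s ! i)) = k \<cdot>\<^sub>v vec n (\<lambda>i. w (s ! i)))" (is "?L \<longleftrightarrow> ?V")
  proof
    assume ?L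
    then obtain v where "v \<in> carrier_vec n" "v \<noteq> 0\<^sub>v n" "?M *\<^sub>v v = k \<cdot>\<^sub>v v" by blast
    moreover from this(1) obtain w where "v = vec n (\<lambda>i. w (s ! i))" using surj by blast
    ultimately show ?V by blast
  qed (use vec_carrier in blast)
  also have "\<dots> \<longleftrightarrow> ?R" unfolding mv nz ..
  finally show ?thesis .
qed

section \<open>Shifts of the torus and irreducibility of its kernel\<close>

lemma site_succ_in_torus: "x \<in> torus N \<Longrightarrow> \<nu> < length N \<Longrightarrow> site_succ N \<nu> x \<in> torus N"
  by (auto simp: torus_def site_succ_def nth_list_update intro!: mod_less_divisor)

lemma site_pred_in_torus: "x \<in> torus N \<Longrightarrow> \<nu> < length N \<Longrightarrow> site_pred N \<nu> x \<in> torus N"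
  by (auto simp: torus_def site_pred_def nth_list_update intro!: mod_less_divisor)

lemma site_pred_succ:
  assumes "x \<in> torus N" "\<nu> < length N"
  shows "site_pred N \<nu> (site_succ N \<nu> x) = x"
proof -
  have x: "x ! \<nu> < N ! \<nu>" "\<nu> < length x" using assms by (auto simp: torus_def)
  have "((x ! \<nu> + 1) mod N ! \<nu> + N ! \<nu> - 1) mod N ! \<nu> = x ! \<nu>"
    \<comment> \<open>The split isolates the wrap-around at the last residue.\<close>
    using x by (cases "x ! \<nu> + 1 = N ! \<nu>") auto
  then show ?thesis using x by (simp add: site_pred_def site_succ_def)
qed

lemma site_succ_pred:
  assumes "x \<in> torus N" "\<nu> < length N"
  shows "site_succ N \<nu> (site_pred N \<nu> x) = x"
proof -
  have x: "x ! \<nu> < N ! \<nu>" "\<nu> < length x" using assms by (auto simp: torus_def)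
  have "((x ! \<nu> + N ! \<nu> - 1) mod N ! \<nu> + 1) mod N ! \<nu> = x ! \<nu>"
    using x by (cases "x ! \<nu>") auto
  then show ?thesis using x by (simp add: site_pred_def site_succ_def)
qed

lemma sum_torus_succ:
  assumes "\<nu> < length N"
  shows "(\<Sum>x\<in>torus N. f (site_succ N \<nu> x)) = (\<Sum>x\<in>torus N. f x)"
  by (rule sum.reindex_bij_witness[of _ "site_pred N \<nu>" "site_succ N \<nu>"])
    (use assms in \<open>auto simp: site_pred_succ site_succ_pred site_succ_in_torus site_pred_in_torus\<close>)

text \<open>Forward steps alone reach every residue of a coordinate by going round the circle; any
  site is then reached by adjusting the coordinates one after another.\<close>

lemma torus_eq_if_succ_closed:
  assumes C: "C \<subseteq> torus N" "C \<noteq> {}"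
    and closed: "\<And>x \<nu>. x \<in> C \<Longrightarrow> \<nu> < length N \<Longrightarrow> site_succ N \<nu> x \<in> C"
  shows "C = torus N"
proof -
  have shift: "x[\<nu> := (x ! \<nu> + j) mod (N ! \<nu>)] \<in> C" if "x \<in> C" "\<nu> < length N" for x \<nu> j
  proof (induction j)
    case 0
    have "x ! \<nu> < N ! \<nu>" using that C by (auto simp: torus_def)
    then show ?case using that by simp
  next
    case (Suc j)
    have "\<nu> < length x" using that C by (auto simp: torus_def)
    with closed[OF Suc that(2)] show ?case by (simp add: site_succ_def mod_Suc_eq)
  qed
  have set: "x[\<nu> := k] \<in> C" if "x \<in> C" "\<nu> < length N" "k < N ! \<nu>" for x \<nu> k
  proof -
    have "x ! \<nu> < N ! \<nu>" using that C by (auto simp: torus_def)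
    \<comment> \<open>This many forward steps lead first to residue 0 and then to
      \<open>k\<close>.\<close>
    then have "(x ! \<nu> + (N ! \<nu> - x ! \<nu> + k)) mod (N ! \<nu>) = k" using that by simp
    with shift[OF that(1,2), of "N ! \<nu> - x ! \<nu> + k"] show ?thesis by simp
  qed
  obtain x where x: "x \<in> C" using C by blast
  have "y \<in> C" if y: "y \<in> torus N" for y
  proof -
    \<comment> \<open>The hybrid site has its first \<open>j\<close> coordinates from
      \<open>y\<close> and the others from \<open>x\<close>.\<close>
    have "j \<le> length N \<Longrightarrow> take j y @ drop j x \<in> C" for j
    proof (induction j)
      case (Suc j)
      have len: "length x = length N" "length y = length N" using x C y by (auto simp: torus_def)
      have "(take j y @ drop j x)[j := y ! j] = take (Suc j) y @ drop (Suc j) x"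
        using Suc.prems len
        by (simp add: list_update_append take_Suc_conv_app_nth Cons_nth_drop_Suc[symmetric])
      with set[of "take j y @ drop j x" j "y ! j"] Suc y show ?case by (simp add: torus_def)
    qed (use x in simp)
    from this[of "length N"] show ?thesis using x C y by (auto simp: torus_def)
  qed
  with C show ?thesis by blast
qed

text \<open>The matrix entries indexed by sites instead of positions in the enumeration.\<close>

definition torus_kernel ::
  "nat list \<Rightarrow> (nat list \<Rightarrow> real) \<Rightarrow> (nat \<Rightarrow> nat list \<Rightarrow> real) \<Rightarrow> (nat \<Rightarrow> nat list \<Rightarrow> real)
    \<Rightarrow> nat list \<Rightarrow> nat list \<Rightarrow> real" where
  "torus_kernel N q rp rm x y = torus_op N q rp rm (\<lambda>z. if z = y then 1 else 0) x"

lemma finite_torus: "finite (torus N)"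
  by (metis List.finite_set set_site_list)

lemma torus_nonempty: "(\<And>\<nu>. \<nu> < length N \<Longrightarrow> N ! \<nu> > 0) \<Longrightarrow> torus N \<noteq> {}"
  by (auto simp: torus_def intro!: exI[of _ "map (\<lambda>_. 0) N"])

lemma torus_op_kernel:
  assumes "x \<in> torus N"
  shows "(\<Sum>y\<in>torus N. torus_kernel N q rp rm x y * u y) = torus_op N q rp rm u x"
proof -
  have delta: "(\<Sum>y\<in>torus N. c * (if z = y then 1 else 0) * u y) = c * u z" if "z \<in> torus N" for z c
  proof -
    have "(\<Sum>y\<in>torus N. c * (if z = y then 1 else 0) * u y) = (\<Sum>y\<in>torus N. if z = y then c * u y else 0)"
      by (intro sum.cong) auto
    then show ?thesis using that by (simp add: finite_torus)
  qed
  have "(\<Sum>y\<in>torus N. torus_kernel N q rp rm x y * u y)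
      = (\<Sum>y\<in>torus N. q x * (if x = y then 1 else 0) * u y)
      + (\<Sum>y\<in>torus N. \<Sum>\<nu><length N. rp \<nu> x * (if site_succ N \<nu> x = y then 1 else 0) * u y
           + rm \<nu> x * (if site_pred N \<nu> x = y then 1 else 0) * u y)"
    unfolding torus_kernel_def torus_op_def distrib_right sum_distrib_right
    by (simp add: sum.distrib)
  also have "\<dots> = torus_op N q rp rm u x"
    unfolding torus_op_def delta[OF assms]
    by (subst sum.swap) (simp add: sum.distrib delta site_succ_in_torus site_pred_in_torus assms)
  finally show ?thesis .
qed

text \<open>The entry from \<open>x\<close> to a successor distinct from \<open>x\<close> is at
  least the forward rate, so a set closed under arrows is closed under
  \<open>site_succ\<close>.\<close>

lemma irreducible_metzler_torus_kernel:
  assumes "\<And>\<nu>. \<nu> < length N \<Longrightarrow> N ! \<nu> > 0"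
    and rp: "\<And>\<nu> x. \<nu> < length N \<Longrightarrow> x \<in> torus N \<Longrightarrow> rp \<nu> x > 0"
    and rm: "\<And>\<nu> x. \<nu> < length N \<Longrightarrow> x \<in> torus N \<Longrightarrow> rm \<nu> x > 0"
  shows "irreducible_metzler (torus N) (torus_kernel N q rp rm)"
proof
  fix x y assume "x \<in> torus N" "y \<in> torus N" "x \<noteq> y"
  then show "torus_kernel N q rp rm x y \<ge> 0"
    using rp rm by (auto simp: torus_kernel_def torus_op_def less_imp_le intro!: sum_nonneg add_nonneg_nonneg)
next
  fix C assume C: "C \<subseteq> torus N" "C \<noteq> {}"
    and closed: "\<And>x y. x \<in> C \<Longrightarrow> y \<in> torus N \<Longrightarrow> x \<noteq> y \<Longrightarrow> torus_kernel N q rp rm x y > 0 \<Longrightarrow> y \<in> C"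
  show "C = torus N"
  proof (rule torus_eq_if_succ_closed[OF C])
    fix x \<nu> assume x: "x \<in> C" and \<nu>: "\<nu> < length N"
    then have xT: "x \<in> torus N" using C by auto
    show "site_succ N \<nu> x \<in> C"
    proof (cases "x = site_succ N \<nu> x")
      case True
      with x show ?thesis by simp
    next
      case False
      have "torus_kernel N q rp rm x (site_succ N \<nu> x) > 0"
        using False rp[OF _ xT] rm[OF _ xT] \<nu>
        by (auto simp: torus_kernel_def torus_op_def less_imp_le intro!: sum_pos2[of _ \<nu>] add_pos_nonneg sum_nonneg)
      with closed[OF x _ False] site_succ_in_torus[OF xT \<nu>] show ?thesis by blast
    qed
  qed
qed (use assms finite_torus torus_nonempty in auto)

section \<open>Free energy and symmetrised matrix in terms of the kernel\<close>

text \<open>Multiplying \<open>kappa\<close> by the exponential of \<open>gam\<close> gives the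
  forward rate, and by that of \<open>- gam\<close> the backward rate; expand
  \<open>cosh\<close>.\<close>

lemma kappa_cosh:
  assumes "rp \<nu> x > 0" "rm \<nu> (site_succ N \<nu> x) > 0"
  shows "2 * kappa N rp rm x \<nu> * cosh (t + gam N rp rm x \<nu>)
    = rp \<nu> x * exp t + rm \<nu> (site_succ N \<nu> x) * exp (- t)"
proof -
  define a b where "a = sqrt (rp \<nu> x)" and "b = sqrt (rm \<nu> (site_succ N \<nu> x))"
  have pos: "a > 0" "b > 0" using assms by (auto simp: a_def b_def)
  have sq: "rp \<nu> x = a * a" "rm \<nu> (site_succ N \<nu> x) = b * b" using assms by (auto simp: a_def b_def)
  have "gam N rp rm x \<nu> = ln (a / b)"
    using pos by (simp add: gam_def sq ln_div ln_mult)
  then have e: "exp (gam N rp rm x \<nu>) = a / b" using pos by simp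
  have "exp (- (t + gam N rp rm x \<nu>)) = exp (- t) * inverse (exp (gam N rp rm x \<nu>))"
    by (simp add: exp_diff exp_minus divide_inverse)
  then have "cosh (t + gam N rp rm x \<nu>) = (exp t * (a / b) + exp (- t) * (b / a)) / 2"
    unfolding cosh_field_def exp_add[of t] e by simp
  moreover have "kappa N rp rm x \<nu> = a * b"
    using pos by (simp add: kappa_def sq real_sqrt_mult)
  ultimately show ?thesis
    using pos unfolding sq by (simp add: field_simps)
qed

text \<open>Each bond joins a site to its successor; its forward and backward hopping terms combine
  by \<open>kappa_cosh\<close>.\<close>

lemma free_energy_eq:
  assumes rp: "\<And>\<nu> x. \<nu> < length N \<Longrightarrow> x \<in> torus N \<Longrightarrow> rp \<nu> x > 0"
    and rm: "\<And>\<nu> x. \<nu> < length N \<Longrightarrow> x \<in> torus N \<Longrightarrow> rm \<nu> x > 0"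
  shows "free_energy N q rp rm a \<beta> =
    (\<Sum>x\<in>torus N. \<Sum>y\<in>torus N. torus_kernel N q rp rm x y * exp (\<beta> y - \<beta> x) * a x * a y)"
proof -
  define f where "f \<nu> x = rm \<nu> x * exp (\<beta> (site_pred N \<nu> x) - \<beta> x) * a x * a (site_pred N \<nu> x)" for \<nu> x
  define g where "g \<nu> x = rp \<nu> x * exp (\<beta> (site_succ N \<nu> x) - \<beta> x) * a x * a (site_succ N \<nu> x)" for \<nu> x
  have "(\<Sum>y\<in>torus N. torus_kernel N q rp rm x y * exp (\<beta> y - \<beta> x) * a x * a y)
      = q x * (a x)\<^sup>2 + (\<Sum>\<nu><length N. g \<nu> x + f \<nu> x)" if "x \<in> torus N" for x
    using torus_op_kernel[OF that, of q rp rm "\<lambda>y. exp (\<beta> y - \<beta> x) * a x * a y"]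
    by (simp add: torus_op_def f_def g_def power2_eq_square mult.assoc)
  then have "(\<Sum>x\<in>torus N. \<Sum>y\<in>torus N. torus_kernel N q rp rm x y * exp (\<beta> y - \<beta> x) * a x * a y)
      = (\<Sum>x\<in>torus N. q x * (a x)\<^sup>2) + (\<Sum>\<nu><length N. (\<Sum>x\<in>torus N. g \<nu> x) + (\<Sum>x\<in>torus N. f \<nu> x))"
    by (simp add: sum.distrib sum.swap[of _ "torus N"])
  \<comment> \<open>Shifting the backward terms \<open>f\<close> by one site places them on the same
    bond as the forward terms \<open>g\<close>.\<close>
  also have "(\<Sum>\<nu><length N. (\<Sum>x\<in>torus N. g \<nu> x) + (\<Sum>x\<in>torus N. f \<nu> x))
      = (\<Sum>\<nu><length N. \<Sum>x\<in>torus N. g \<nu> x + f \<nu> (site_succ N \<nu> x))"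
    by (simp add: sum_torus_succ sum.distrib)
  also have "\<dots> = (\<Sum>\<nu><length N. \<Sum>x\<in>torus N. 2 * (kappa N rp rm x \<nu> * a x * a (site_succ N \<nu> x)
                * cosh (\<beta> (site_succ N \<nu> x) - \<beta> x + gam N rp rm x \<nu>)))"
  proof (intro sum.cong refl)
    fix \<nu> x assume "\<nu> \<in> {..<length N}" and x: "x \<in> torus N"
    then have \<nu>: "\<nu> < length N" by simp
    define y where "y = site_succ N \<nu> x"
    have "g \<nu> x + f \<nu> y = (rp \<nu> x * exp (\<beta> y - \<beta> x) + rm \<nu> y * exp (- (\<beta> y - \<beta> x))) * (a x * a y)"
      using site_pred_succ[OF x \<nu>] by (simp add: f_def g_def y_def algebra_simps)
    also have "\<dots> = 2 * (kappa N rp rm x \<nu> * a x * a y * cosh (\<beta> y - \<beta> x + gam N rp rm x \<nu>))"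
      using kappa_cosh[of rp \<nu> x rm N "\<beta> y - \<beta> x"] rp[OF \<nu> x] rm[OF \<nu> site_succ_in_torus[OF x \<nu>]]
      by (simp add: y_def[symmetric] mult_ac flip: distrib_right)
    finally show "g \<nu> x + f \<nu> (site_succ N \<nu> x) = 2 * (kappa N rp rm x \<nu> * a x * a (site_succ N \<nu> x)
        * cosh (\<beta> (site_succ N \<nu> x) - \<beta> x + gam N rp rm x \<nu>))"
      by (simp add: y_def)
  qed
  also have "\<dots> = 2 * (\<Sum>x\<in>torus N. \<Sum>\<nu><length N. kappa N rp rm x \<nu> * a x * a (site_succ N \<nu> x)
                * cosh (\<beta> (site_succ N \<nu> x) - \<beta> x + gam N rp rm x \<nu>))"
    by (subst sum.swap) (simp add: sum_distrib_left)
  finally show ?thesis by (simp add: free_energy_def)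
qed

lemma torus_mat_eq: "torus_mat N q rp rm = mat (length (site_list N)) (length (site_list N))
    (\<lambda>(i, j). torus_kernel N q rp rm (site_list N ! i) (site_list N ! j))"
  by (simp add: torus_mat_def torus_kernel_def)

text \<open>Multiplying by diagonal matrices scales rows and columns, so the identity is checked
  entrywise. The locale predicate is what allows \<open>sym_part\<close> to be unfolded.\<close>

lemma sym_conj_eq:
  assumes "irreducible_metzler (torus N) (torus_kernel N q rp rm)"
  shows "sym_conj N q rp rm \<beta> = mat (length (site_list N)) (length (site_list N))
    (\<lambda>(i, j). irreducible_metzler.sym_part (torus_kernel N q rp rm) \<beta> (site_list N ! i) (site_list N ! j))"
proof (rule eq_matI)
  let ?n = "length (site_list N)" let ?s = "(!) (site_list N)"
  let ?K = "torus_kernel N q rp rm"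
  let ?M = "torus_mat N q rp rm"
  have M: "?M \<in> carrier_mat ?n ?n" "transpose_mat ?M \<in> carrier_mat ?n ?n"
    by (auto simp: torus_mat_def)
  have conj: "mat_diag ?n f * B * mat_diag ?n g = mat ?n ?n (\<lambda>(i, j). f i * B $$ (i, j) * g j)"
    if "B \<in> carrier_mat ?n ?n" for f g and B :: "real mat"
    by (rule eq_matI) (use that in \<open>auto simp: mat_diag_mult_left[OF that] mat_diag_mult_right[of _ ?n ?n]\<close>)
  fix i j
  assume "i < dim_row (mat ?n ?n (\<lambda>(i, j). irreducible_metzler.sym_part ?K \<beta> (?s i) (?s j)))"
    and "j < dim_col (mat ?n ?n (\<lambda>(i, j). irreducible_metzler.sym_part ?K \<beta> (?s i) (?s j)))"
  then have ij: "i < ?n" "j < ?n" by auto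
  have "sym_conj N q rp rm \<beta> $$ (i, j) =
      (exp (- \<beta> (?s i)) * ?K (?s i) (?s j) * exp (\<beta> (?s j))
        + exp (\<beta> (?s i)) * ?K (?s j) (?s i) * exp (- \<beta> (?s j))) / 2"
    unfolding sym_conj_def Let_def exp_diag_def conj[OF M(1)] conj[OF M(2)]
    using ij by (simp add: torus_mat_eq)
  also have "\<dots> = irreducible_metzler.sym_part ?K \<beta> (?s i) (?s j)"
    unfolding irreducible_metzler.sym_part_def[OF assms] by (simp add: exp_diff exp_minus field_simps)
  finally show "sym_conj N q rp rm \<beta> $$ (i, j)
      = mat ?n ?n (\<lambda>(i, j). irreducible_metzler.sym_part ?K \<beta> (?s i) (?s j)) $$ (i, j)"
    using ij by simp
qed (auto simp: sym_conj_def exp_diag_def mat_diag_def Let_def)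

section \<open>Largest eigenvalue and spectral bound of the indexed matrices\<close>

text \<open>The Perron vector attains \<open>\<mu>\<close>. An eigenvector \<open>w\<close> for
  \<open>k\<close> has energy \<open>k\<close> times its squared norm, so the Rayleigh bound, valid
  also for vectors of mixed sign, yields \<open>k \<le> \<mu>\<close>.\<close>

lemma (in irreducible_metzler) has_max_energy:
  assumes s: "distinct s" "set s = S"
  shows "has_max (unit_amplitudes S) (\<lambda>a. energy a \<beta>)
    (max_eigenvalue (mat (length s) (length s) (\<lambda>(i, j). sym_part \<beta> (s ! i) (s ! j))))"
proof -
  let ?H = "mat (length s) (length s) (\<lambda>(i, j). sym_part \<beta> (s ! i) (s ! j))"
  obtain \<mu> a where a: "a \<in> unit_amplitudes S"
    and Ha: "\<And>x. x \<in> S \<Longrightarrow> (\<Sum>y\<in>S. sym_part \<beta> x y * a y) = \<mu> * a x"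
    and \<mu>: "energy a \<beta> = \<mu>" "\<And>b. energy b \<beta> \<le> \<mu> * (\<Sum>x\<in>S. (b x)\<^sup>2)"
    using sym_part_top_eigenvector[of \<beta>] by blast
  have spec: "k \<in> spectrum ?H \<longleftrightarrow>
      (\<exists>w. (\<exists>x\<in>S. w x \<noteq> 0) \<and> (\<forall>x\<in>S. (\<Sum>y\<in>S. sym_part \<beta> x y * w y) = k * w x))" for k
    using spectrum_indexed_mat[OF s(1), of k "sym_part \<beta>"] by (simp add: s)
  have eig: "max_eigenvalue ?H = \<mu>" unfolding max_eigenvalue_def
  proof (rule Max_eqI)
    show "finite (spectrum ?H)" by (rule card_finite_spectrum(1)[of _ "length s"]) simp
    have "\<exists>x\<in>S. a x \<noteq> 0" using a nonempty by (force simp: unit_amplitudes_def)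
    with Ha show "\<mu> \<in> spectrum ?H" unfolding spec by blast
  next
    fix k assume "k \<in> spectrum ?H"
    then obtain w x where x: "x \<in> S" "w x \<noteq> 0"
      and w: "\<And>x. x \<in> S \<Longrightarrow> (\<Sum>y\<in>S. sym_part \<beta> x y * w y) = k * w x" unfolding spec by blast
    have "energy w \<beta> = (\<Sum>x\<in>S. w x * (\<Sum>y\<in>S. sym_part \<beta> x y * w y))"
      by (simp add: energy_sym_part sum_distrib_left mult_ac)
    also have "\<dots> = k * (\<Sum>x\<in>S. (w x)\<^sup>2)"
      unfolding sum_distrib_left[of k] by (intro sum.cong refl) (simp add: w power2_eq_square)
    finally have "k * (\<Sum>x\<in>S. (w x)\<^sup>2) \<le> \<mu> * (\<Sum>x\<in>S. (w x)\<^sup>2)" using \<mu>(2)[of w] by simp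
    moreover have "(\<Sum>x\<in>S. (w x)\<^sup>2) > 0" using x fin by (intro sum_pos2[of S x]) auto
    ultimately show "k \<le> \<mu>" by simp
  qed
  have "energy b \<beta> \<le> \<mu>" if "b \<in> unit_amplitudes S" for b
    using \<mu>(2)[of b] that by (simp add: unit_amplitudes_def)
  then show ?thesis unfolding has_max_def eig using a \<mu>(1) by blast
qed

lemma (in irreducible_metzler) spectral_bound_eqI:
  assumes s: "distinct s" "set s = S"
    and u: "\<And>x. x \<in> S \<Longrightarrow> u x > 0" "\<And>x. x \<in> S \<Longrightarrow> (\<Sum>y\<in>S. A x y * u y) = \<mu> * u x"
    and le: "\<And>(k::complex) w. \<exists>x\<in>S. w x \<noteq> 0 \<Longrightarrow>
      \<forall>x\<in>S. (\<Sum>y\<in>S. complex_of_real (A x y) * w y) = k * w x \<Longrightarrow> Re k \<le> \<mu>"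
  shows "spectral_bound (mat (length s) (length s) (\<lambda>(i, j). A (s ! i) (s ! j))) = \<mu>"
proof -
  let ?M = "mat (length s) (length s) (\<lambda>(i, j). complex_of_real (A (s ! i) (s ! j)))"
  have M: "map_mat complex_of_real (mat (length s) (length s) (\<lambda>(i, j). A (s ! i) (s ! j))) = ?M"
    by (rule eq_matI) auto
  have spec: "k \<in> spectrum ?M \<longleftrightarrow>
      (\<exists>w. (\<exists>x\<in>S. w x \<noteq> 0) \<and> (\<forall>x\<in>S. (\<Sum>y\<in>S. complex_of_real (A x y) * w y) = k * w x))" for k
    using spectrum_indexed_mat[OF s(1), of k "\<lambda>x y. complex_of_real (A x y)"] by (simp add: s)
  have "complex_of_real \<mu> \<in> spectrum ?M" unfolding spec
  proof (intro exI conjI ballI)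
    show "\<exists>x\<in>S. complex_of_real (u x) \<noteq> 0" using u(1) nonempty by force
    show "(\<Sum>y\<in>S. complex_of_real (A x y) * complex_of_real (u y)) = complex_of_real \<mu> * complex_of_real (u x)"
      if "x \<in> S" for x
      using arg_cong[OF u(2)[OF that], of complex_of_real] by simp
  qed
  then have "\<mu> \<in> Re ` spectrum ?M" by force
  moreover have "finite (spectrum ?M)" by (rule card_finite_spectrum(1)[of _ "length s"]) simp
  moreover have "r \<le> \<mu>" if r: "r \<in> Re ` spectrum ?M" for r
  proof -
    obtain k where k: "k \<in> spectrum ?M" "r = Re k" using r by blast
    from k(1) obtain w where "\<exists>x\<in>S. w x \<noteq> 0"
      "\<forall>x\<in>S. (\<Sum>y\<in>S. complex_of_real (A x y) * w y) = k * w x" unfolding spec by (elim exE conjE)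
    then show ?thesis unfolding k(2) by (rule le)
  qed
  ultimately show ?thesis unfolding spectral_bound_def M by (intro Max_eqI finite_imageI)
qed

theorem theorem1p1:
  fixes m :: nat and N :: "nat list"
    and q :: "nat list \<Rightarrow> real" and rp rm :: "nat \<Rightarrow> nat list \<Rightarrow> real"
  assumes "m \<ge> 1" and "length N = m" and "\<And>\<nu>. \<nu> < m \<Longrightarrow> N ! \<nu> \<ge> 3"
    and "\<And>\<nu> x. \<nu> < m \<Longrightarrow> x \<in> torus N \<Longrightarrow> rp \<nu> x > 0"
    and "\<And>\<nu> x. \<nu> < m \<Longrightarrow> x \<in> torus N \<Longrightarrow> rm \<nu> x > 0"
  shows "has_min (potentials N) (\<lambda>\<beta>. max_eigenvalue (sym_conj N q rp rm \<beta>))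
           (principal_eigenvalue N q rp rm)
       \<and> (\<exists>G. (\<forall>\<beta>\<in>potentials N. has_max (amplitudes N) (\<lambda>a. free_energy N q rp rm a \<beta>) (G \<beta>))
              \<and> has_min (potentials N) G (principal_eigenvalue N q rp rm))
       \<and> (\<exists>g. (\<forall>a\<in>amplitudes N. has_min (potentials N) (\<lambda>\<beta>. free_energy N q rp rm a \<beta>) (g a))
              \<and> has_max (amplitudes N) g (principal_eigenvalue N q rp rm))"
proof -
  let ?\<Lambda> = "principal_eigenvalue N q rp rm"
  \<comment> \<open>As the value of the inner maximum over amplitudes, \<open>G\<close> makes the
    first two equalities one assertion.\<close>
  define G where "G \<beta> = max_eigenvalue (sym_conj N q rp rm \<beta>)" for \<beta>
  note [simp] = assms(2)
  have "N ! \<nu> > 0" if "\<nu> < m" for \<nu> using assms(3)[OF that] by simp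
  then have irr: "irreducible_metzler (torus N) (torus_kernel N q rp rm)"
    using assms by (intro irreducible_metzler_torus_kernel) auto
  interpret irreducible_metzler "torus N" "torus_kernel N q rp rm" by (rule irr)
  have energy: "free_energy N q rp rm a \<beta> = energy a \<beta>" for a \<beta>
    unfolding energy_def using assms by (intro free_energy_eq) auto
  have sets: "potentials N = zero_sum (torus N)" "amplitudes N = unit_amplitudes (torus N)"
    by (simp_all add: potentials_def zero_sum_def amplitudes_def unit_amplitudes_def)
  have G: "has_max (unit_amplitudes (torus N)) (\<lambda>a. energy a \<beta>) (G \<beta>)" for \<beta>
    unfolding G_def sym_conj_eq[OF irr] by (rule has_max_energy[OF distinct_site_list set_site_list])
  obtain \<mu> u a \<beta> where u: "\<And>x. x \<in> torus N \<Longrightarrow> u x > 0"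
      "\<And>x. x \<in> torus N \<Longrightarrow> (\<Sum>y\<in>torus N. torus_kernel N q rp rm x y * u y) = \<mu> * u x"
    and saddle: "a \<in> unit_amplitudes (torus N)" "\<beta> \<in> zero_sum (torus N)"
      "\<And>b. energy b \<beta> \<le> \<mu> * (\<Sum>x\<in>torus N. (b x)\<^sup>2)" "\<And>\<alpha>. \<mu> \<le> energy a \<alpha>"
    and le: "\<And>(k::complex) w. \<exists>x\<in>torus N. w x \<noteq> 0 \<Longrightarrow>
      \<forall>x\<in>torus N. (\<Sum>y\<in>torus N. complex_of_real (torus_kernel N q rp rm x y) * w y) = k * w x \<Longrightarrow> Re k \<le> \<mu>"
    using saddle_point by blast
  have \<mu>: "?\<Lambda> = \<mu>"
    unfolding principal_eigenvalue_def torus_mat_eq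
    by (rule spectral_bound_eqI[OF distinct_site_list set_site_list u le])
  have "energy b \<beta> \<le> \<mu>" if "b \<in> unit_amplitudes (torus N)" for b
    using saddle(3)[of b] that by (simp add: unit_amplitudes_def)
  note minimax = minimax[OF G saddle(1,2) this saddle(4)]
  show ?thesis
    unfolding energy sets \<mu> G_def[symmetric] using G minimax by blast
qed

end
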